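(* Let $t\ge 10$ be an integer and let $n$ be an integer with $n\ge 200t^2\ln t + 400t^2$. Then every coloring of the edges of the complete $3$-uniform hypergraph on $n$ vertices with two colors contains a monochromatic copy of the hedgehog $H_t$. That is, $$r(H_t) < 200t^2\ln t + 400t^2+1.$$
   Context: The hedgehog $H_t$ is the $3$-uniform hypergraph on $t+\binom{t}{2}$ vertices $1,\dots,t+\binom t2$ such that for each pair $1\le i<j\le t$ there is a unique vertex $k=k(i,j)>t$ such that $\{i,j,k\}$ is an edge (distinct pairs having distinct vertices $k$), and there are no other edges. A monochromatic copy of $H_t$ in a $2$-colored complete $3$-uniform hypergraph is an injective map of the vertices of $H_t$ into the vertex set such that the images of all edges of $H_t$ receive the same color. The Ramsey number $r(H_t)$ is the smallest $n$ such that every $2$-coloring of the edges (all $3$-element subsets) of the complete $3$-uniform hypergraph on $n$ vertices contains a monochromatic copy of $H_t$. *)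

theory Defs
  imports Complex_Main "HOL-Library.Ramsey"
begin

text \<open>A hypergraph is a pair of a vertex set and a set of edges.\<close>

type_synonym 'a hypergraph = "'a set \<times> 'a set set"

definition complete_3graph :: "nat \<Rightarrow> nat hypergraph" where
  "complete_3graph n = ({..<n}, nsets {..<n} 3)"

text \<open>
  The hedgehog is determined by \<open>t\<close> only up to the choice of the injective labelling \<open>k\<close>,
  hence up to isomorphism, so it is given as a predicate. Injectivity of \<open>k\<close> on the
  \<open>t choose 2\<close> pairs makes every vertex above \<open>t\<close> a value of \<open>k\<close>.
\<close>

definition is_hedgehog :: "nat \<Rightarrow> nat hypergraph \<Rightarrow> bool" where
  "is_hedgehog t H \<longleftrightarrow>
     (\<exists>k :: nat \<Rightarrow> nat \<Rightarrow> nat.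
        (\<forall>i j. 1 \<le> i \<and> i < j \<and> j \<le> t \<longrightarrow> k i j \<in> {t<..t + (t choose 2)}) \<and>
        inj_on (\<lambda>(i, j). k i j) {(i, j). 1 \<le> i \<and> i < j \<and> j \<le> t} \<and>
        H = ({1..t + (t choose 2)}, {{i, j, k i j} | i j. 1 \<le> i \<and> i < j \<and> j \<le> t}))"

text \<open>
  A 2-colouring of the edges of \<open>G\<close> is a function to \<open>bool\<close>; its values outside the
  edge set are irrelevant, since every image of an edge is required to be an edge of \<open>G\<close>.
\<close>

definition has_mono_copy :: "'a hypergraph \<Rightarrow> 'b hypergraph \<Rightarrow> ('b set \<Rightarrow> bool) \<Rightarrow> bool" where
  "has_mono_copy H G c \<longleftrightarrow>
     (\<exists>f b. inj_on f (fst H) \<and> f ` fst H \<subseteq> fst G \<and>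
        (\<forall>e\<in>snd H. f ` e \<in> snd G \<and> c (f ` e) = b))"

definition arrows :: "nat \<Rightarrow> 'a hypergraph \<Rightarrow> bool" where
  "arrows n H \<longleftrightarrow> (\<forall>c. has_mono_copy H (complete_3graph n) c)"

text \<open>Meaningful only if some \<open>n\<close> satisfies \<open>arrows n H\<close>.\<close>

definition ramsey_number :: "'a hypergraph \<Rightarrow> nat" where
  "ramsey_number H = (LEAST n. arrows n H)"

lemma hedgehog_exists: "\<exists>H. is_hedgehog t H"
proof -
  have "card (nsets {1..t} 2) = t choose 2" by simp
  then obtain g where g: "bij_betw g (nsets {1..t} 2) {t<..t + (t choose 2)}"
    using finite_same_card_bij[of "nsets {1..t} 2" "{t<..t + (t choose 2)}"]
    by (auto simp: finite_imp_finite_nsets)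
  have mem: "{i, j} \<in> nsets {1..t} 2" if "1 \<le> i" "i < j" "j \<le> t" for i j
    using that by (auto simp: nsets_def)
  have "inj_on (\<lambda>(i, j). g {i, j}) {(i, j). 1 \<le> i \<and> i < j \<and> j \<le> t}"
  proof (rule inj_onI, clarify)
    fix i j i' j' :: nat
    assume a: "1 \<le> i" "i < j" "j \<le> t" "1 \<le> i'" "i' < j'" "j' \<le> t" "g {i, j} = g {i', j'}"
    then have "{i, j} = {i', j'}"
      using mem g by (meson bij_betw_imp_inj_on inj_onD)
    with a show "i = i' \<and> j = j'" by (auto simp: doubleton_eq_iff)
  qed
  moreover have "\<forall>i j. 1 \<le> i \<and> i < j \<and> j \<le> t \<longrightarrow> g {i, j} \<in> {t<..t + (t choose 2)}"
    using mem g by (meson bij_betwE)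
  ultimately show ?thesis
    unfolding is_hedgehog_def
    by (intro exI[of _ "({1..t + (t choose 2)},
          {{i, j, g {i, j}} | i j. 1 \<le> i \<and> i < j \<and> j \<le> t})"] exI[of _ "\<lambda>i j. g {i, j}"]) simp
qed

end

theory Submission
  imports Defs
begin

text \<open>
  The codegree of a pair in a colour is the number of triples of that colour containing it. Repeatedly
  remove a vertex \<open>v\<close> for which, at some scale \<open>d\<close> between \<open>6t\<close> and \<open>10t\<^sup>2\<close>, at least \<open>3d\<close> of the
  remaining vertices have codegree below \<open>d\<close> with \<open>v\<close> in one of the colours; take \<open>d\<close> minimal and
  let \<open>3d\<close> of these vertices be the star of \<open>v\<close>. Almost all triples containing \<open>v\<close> and a vertex of
  its star then have the other colour, say blue. So the star supplies at least \<open>2d\<close> blue spines for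
  all pairs \<open>{v, u}\<close> with fewer than \<open>3d\<close> exceptions, and by minimality of \<open>d\<close> few of the exceptional
  pairs have small blue codegree. Vertices lying in too many stars are discarded. In the end one
  colour is good for at least \<open>n / 3\<close> vertices, namely the remaining ones and the centres of that colour.

  Within this set choose \<open>2t\<close> vertices at random. On average the reciprocal codegrees of the
  exceptional pairs have sum \<open>O(t\<^sup>2 ln t / n)\<close>, few of them have codegree below \<open>6t\<close>, and the stars
  overlap little. After deleting \<open>t\<close> vertices, these bounds give a fractional assignment of
  spines to the pairs of the remaining \<open>t\<close> vertices, and Hall's theorem makes it integral.
\<close>

section \<open>Fractional marriage and averaging\<close>

text \<open>Halmos-Vaughan induction. If some proper nonempty \<open>J\<close> is tight, it is
  matched first and Hall's condition survives for the rest outside its neighbourhood; otherwise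
  every such \<open>J\<close> has a surplus, so one element may be matched arbitrarily.\<close>

lemma hall_marriage:
  fixes M :: "'i \<Rightarrow> 'a set"
  assumes "finite I" and "\<And>i. i \<in> I \<Longrightarrow> finite (M i)"
    and "\<And>J. J \<subseteq> I \<Longrightarrow> card J \<le> card (\<Union>(M ` J))"
  shows "\<exists>r. inj_on r I \<and> (\<forall>i\<in>I. r i \<in> M i)"
  using assms
proof (induction "card I" arbitrary: I M rule: less_induct)
  case less
  note fin = less.prems(1) and finM = less.prems(2) and hall = less.prems(3)
  show ?case
  proof (cases "\<exists>J. J \<subset> I \<and> J \<noteq> {} \<and> card (\<Union>(M ` J)) \<le> card J")
    case True
    then obtain J where J: "J \<subset> I" "J \<noteq> {}" "card (\<Union>(M ` J)) \<le> card J" by blast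
    define W where "W = \<Union>(M ` J)"
    have finJ: "finite J" using J(1) fin finite_subset by blast
    have finW: "finite W" unfolding W_def using finJ finM J(1) by blast
    have cW: "card W = card J" using J hall[of J] unfolding W_def by auto
    have "card J < card I" using J(1) fin by (rule psubset_card_mono[rotated])
    then obtain r1 where r1: "inj_on r1 J" "\<forall>i\<in>J. r1 i \<in> M i"
      using less.hyps[of J M] finJ finM hall J(1)
      by (metis (no_types, lifting) psubset_imp_subset subsetD subset_trans)
    have c2: "card (I - J) < card I"
      using J fin finJ by (metis Diff_subset card_Diff_subset card_gt_0_iff card_mono diff_less
          order_less_le_trans psubset_imp_subset)
    have "\<exists>r. inj_on r (I - J) \<and> (\<forall>i\<in>I - J. r i \<in> M i - W)"
    proof (rule less.hyps[OF c2])
      fix K assume K: "K \<subseteq> I - J"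
      have finK: "finite K" using K fin finite_subset by blast
      have finU: "finite (\<Union>(M ` K))" using K finM finK by blast
      have "card K + card J = card (K \<union> J)"
        using K finK finJ by (subst card_Un_disjoint) auto
      also have "\<dots> \<le> card (\<Union>(M ` (K \<union> J)))" using hall[of "K \<union> J"] K J(1) by blast
      also have "\<Union>(M ` (K \<union> J)) = \<Union>((\<lambda>i. M i - W) ` K) \<union> W" unfolding W_def by auto
      also have "card \<dots> \<le> card (\<Union>((\<lambda>i. M i - W) ` K)) + card W" by (rule card_Un_le)
      finally show "card K \<le> card (\<Union>((\<lambda>i. M i - W) ` K))" using cW by simp
    qed (use fin finM in auto)
    then obtain r2 where r2: "inj_on r2 (I - J)" "\<forall>i\<in>I - J. r2 i \<in> M i - W" by blast
    let ?r = "\<lambda>i. if i \<in> J then r1 i else r2 i"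
    have W1: "r1 i \<in> W" if "i \<in> J" for i using that r1(2) unfolding W_def by blast
    have "inj_on ?r I"
    proof (rule inj_onI)
      fix i j assume ij: "i \<in> I" "j \<in> I" "?r i = ?r j"
      have "r2 j \<notin> W" if "j \<in> I - J" for j using r2(2) that by blast
      with ij W1 have "i \<in> J \<longleftrightarrow> j \<in> J" by (metis DiffI)
      with ij r1(1) r2(1) show "i = j" by (auto simp: inj_on_def split: if_splits)
    qed
    moreover have "\<forall>i\<in>I. ?r i \<in> M i" using r1 r2 by auto
    ultimately show ?thesis by blast
  next
    case False
    show ?thesis
    proof (cases "I = {}")
      case False
      then obtain i where i: "i \<in> I" by blast
      have "card {i} \<le> card (M i)" using hall[of "{i}"] i by auto
      then obtain x where x: "x \<in> M i" by fastforce
      have c: "card (I - {i}) < card I" using i fin by (meson card_Diff1_less)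
      have "\<exists>r. inj_on r (I - {i}) \<and> (\<forall>j\<in>I - {i}. r j \<in> M j - {x})"
      proof (rule less.hyps[OF c])
        fix K assume K: "K \<subseteq> I - {i}"
        show "card K \<le> card (\<Union>((\<lambda>j. M j - {x}) ` K))"
        proof (cases "K = {}")
          case False
          have "K \<subset> I" using K i by blast
          then have "card K < card (\<Union>(M ` K))"
            using \<open>\<not> (\<exists>J. J \<subset> I \<and> J \<noteq> {} \<and> card (\<Union>(M ` J)) \<le> card J)\<close> False
            by (meson not_le)
          moreover have "\<Union>((\<lambda>j. M j - {x}) ` K) = \<Union>(M ` K) - {x}" by auto
          moreover have "card (\<Union>(M ` K)) - card {x} \<le> card (\<Union>(M ` K) - {x})"
            by (rule diff_card_le_card_Diff) simp
          ultimately show ?thesis by simp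
        qed simp
      qed (use fin finM in auto)
      then obtain r where r: "inj_on r (I - {i})" "\<forall>j\<in>I - {i}. r j \<in> M j - {x}" by blast
      have "inj_on (r(i := x)) I" using r by (auto simp: inj_on_def)
      moreover have "\<forall>j\<in>I. (r(i := x)) j \<in> M j" using r x by auto
      ultimately show ?thesis by blast
    qed auto
  qed
qed

text \<open>Double counting: the indices in \<open>J\<close> send weight at least
  \<open>card J\<close> into \<open>W\<close>, and each point of \<open>W\<close> receives at most
  1, which is Hall's condition.\<close>

lemma fractional_marriage:
  fixes M :: "'i \<Rightarrow> 'a set" and f :: "'i \<Rightarrow> 'a \<Rightarrow> real"
  assumes fin: "finite I" and finM: "\<And>i. i \<in> I \<Longrightarrow> finite (M i)"
    and nn: "\<And>i x. i \<in> I \<Longrightarrow> f i x \<ge> 0"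
    and one: "\<And>i. i \<in> I \<Longrightarrow> (\<Sum>x\<in>M i. f i x) \<ge> 1"
    and load: "\<And>x. (\<Sum>i\<in>I. if x \<in> M i then f i x else 0) \<le> 1"
  shows "\<exists>r. inj_on r I \<and> (\<forall>i\<in>I. r i \<in> M i)"
proof (rule hall_marriage[OF fin finM])
  fix J assume J: "J \<subseteq> I"
  define W where "W = \<Union>(M ` J)"
  have finJ: "finite J" using J fin finite_subset by blast
  have finW: "finite W" unfolding W_def using finJ finM J by blast
  have "real (card J) \<le> (\<Sum>i\<in>J. \<Sum>x\<in>M i. f i x)"
    using sum_mono[of J "\<lambda>_. 1" "\<lambda>i. \<Sum>x\<in>M i. f i x"] one J by auto
  also have "\<dots> = (\<Sum>i\<in>J. \<Sum>x\<in>W. if x \<in> M i then f i x else 0)"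
  proof (rule sum.cong[OF refl])
    fix i assume "i \<in> J"
    then have "W \<inter> M i = M i" unfolding W_def by auto
    then show "(\<Sum>x\<in>M i. f i x) = (\<Sum>x\<in>W. if x \<in> M i then f i x else 0)"
      using sum.inter_restrict[OF finW, of "f i" "M i"] by simp
  qed
  also have "\<dots> = (\<Sum>x\<in>W. \<Sum>i\<in>J. if x \<in> M i then f i x else 0)" by (rule sum.swap)
  also have "\<dots> \<le> (\<Sum>x\<in>W. 1)"
  proof (rule sum_mono)
    fix x
    have "(\<Sum>i\<in>J. if x \<in> M i then f i x else 0) \<le> (\<Sum>i\<in>I. if x \<in> M i then f i x else 0)"
      by (rule sum_mono2[OF fin J]) (use nn in auto)
    with load[of x] show "(\<Sum>i\<in>J. if x \<in> M i then f i x else 0) \<le> 1" by simp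
  qed
  finally show "card J \<le> card (\<Union>(M ` J))" unfolding W_def by simp
qed auto

text \<open>A first-moment bound for a random \<open>s\<close>-subset, derandomised by deleting one
  vertex at a time; the factors \<open>((k - 1) / k)\<^sup>2\<close> telescope.\<close>

lemma sparse_subset:
  fixes g :: "'a \<Rightarrow> 'a \<Rightarrow> real"
  assumes "finite X" and "s \<le> card X" and "s \<ge> 1"
    and nn: "\<And>u v. g u v \<ge> 0" and irr: "\<And>v. g v v = 0"
  shows "\<exists>S\<subseteq>X. card S = s \<and> (\<Sum>u\<in>S. \<Sum>v\<in>S. g u v) \<le> (s / card X)\<^sup>2 * (\<Sum>u\<in>X. \<Sum>v\<in>X. g u v)"
  using assms(1,2)
proof (induction "card X" arbitrary: X rule: less_induct)
  case less
  note fin = less.prems(1)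
  let ?G = "\<lambda>X. \<Sum>u\<in>X. \<Sum>v\<in>X. g u v"
  show ?case
  proof (cases "card X = s")
    case True
    then show ?thesis using assms(3) by (intro exI[of _ X]) auto
  next
    case False
    define k where "k = card X"
    have k: "k > s" "k \<ge> 2" using False less.prems assms(3) unfolding k_def by auto
    txt \<open>Deleting a vertex of at least average degree multiplies the sum by at most
      \<open>1 - 2 / k \<le> ((k - 1) / k)\<^sup>2\<close>.\<close>
    define r where "r x = (\<Sum>v\<in>X. g x v) + (\<Sum>u\<in>X. g u x)" for x
    have rm: "?G (X - {x}) = ?G X - r x" if "x \<in> X" for x
    proof -
      have "?G X = (\<Sum>v\<in>X. g x v) + (\<Sum>u\<in>X - {x}. \<Sum>v\<in>X. g u v)"
        by (rule sum.remove[OF fin that])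
      also have "(\<Sum>u\<in>X - {x}. \<Sum>v\<in>X. g u v) = (\<Sum>u\<in>X - {x}. g u x + (\<Sum>v\<in>X - {x}. g u v))"
        by (intro sum.cong refl sum.remove[OF fin that])
      also have "\<dots> = (\<Sum>u\<in>X - {x}. g u x) + ?G (X - {x})" by (rule sum.distrib)
      also have "(\<Sum>u\<in>X - {x}. g u x) = (\<Sum>u\<in>X. g u x)"
        using sum.remove[OF fin that, of "\<lambda>u. g u x"] irr by simp
      finally show ?thesis unfolding r_def by simp
    qed
    have tot: "(\<Sum>x\<in>X. r x) = 2 * ?G X"
      unfolding r_def by (simp add: sum.distrib, rule sum.swap)
    have "\<exists>x\<in>X. r x \<ge> 2 * ?G X / k"
    proof (rule ccontr)
      assume "\<not> ?thesis"
      then have lt: "\<And>x. x \<in> X \<Longrightarrow> r x < 2 * ?G X / k" by force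
      have "X \<noteq> {}" using k k_def by auto
      then have "(\<Sum>x\<in>X. r x) < (\<Sum>x\<in>X. 2 * ?G X / k)"
        using lt fin by (intro sum_strict_mono) auto
      then show False using tot k k_def by simp
    qed
    then obtain x where x: "x \<in> X" "r x \<ge> 2 * ?G X / k" by blast
    have cx: "card (X - {x}) = k - 1" using x(1) k_def by simp
    obtain S where S: "S \<subseteq> X - {x}" "card S = s"
      "?G S \<le> (s / card (X - {x}))\<^sup>2 * ?G (X - {x})"
      using less.hyps[of "X - {x}"] fin k cx k_def by fastforce
    have G0: "?G X \<ge> 0" by (intro sum_nonneg nn)
    have k1: "real (k - 1) = real k - 1" using k by simp
    have "?G S \<le> (s / (real k - 1))\<^sup>2 * (?G X - r x)" using S(3) cx rm[OF x(1)] k1 by simp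
    also have "\<dots> \<le> (s / (real k - 1))\<^sup>2 * (?G X * (1 - 2 / k))"
      using x(2) by (intro mult_left_mono) (auto simp: field_simps)
    also have "\<dots> = (s\<^sup>2 * ?G X) * ((1 - 2 / k) / (real k - 1)\<^sup>2)"
      by (simp add: power_divide)
    also have "\<dots> \<le> (s\<^sup>2 * ?G X) * (1 / (real k)\<^sup>2)"
    proof (rule mult_left_mono)
      have "(1 - 2 / real k) * (real k)\<^sup>2 \<le> (real k - 1)\<^sup>2"
        using k by (simp add: power2_eq_square field_simps)
      then show "(1 - 2 / real k) / (real k - 1)\<^sup>2 \<le> 1 / (real k)\<^sup>2"
        using k by (simp add: divide_simps mult.commute)
    qed (use G0 in simp)
    finally have "?G S \<le> (s / card X)\<^sup>2 * ?G X" by (simp add: power_divide k_def)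
    then show ?thesis using S by blast
  qed
qed

text \<open>Partial summation: a counting function of size at most \<open>C * j\<close> at every
  scale turns the reciprocal sum into a harmonic one, hence the logarithm.\<close>

lemma sum_inverse_le_ln:
  fixes c :: "'a \<Rightarrow> nat"
  assumes fin: "finite F" and a: "a \<ge> 2" "a \<le> m"
    and le: "\<And>j. a \<le> j \<Longrightarrow> j \<le> m \<Longrightarrow> real (card {u \<in> F. c u < j}) \<le> C * real j"
  shows "(\<Sum>u\<in>{u \<in> F. a \<le> c u \<and> c u < m}. 1 / c u) \<le> C * (1 + ln (real m / (real a - 1)))"
proof -
  define f where "f j = real (card {u \<in> F. c u < j})" for j
  define G where "G j = (\<Sum>u\<in>{u \<in> F. a \<le> c u \<and> c u < j}. 1 / real (c u))" for j
  have C0: "C \<ge> 0" using le[of a] a by (smt (verit) of_nat_0_le_iff of_nat_0_less_iff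
        zero_le_mult_iff not_numeral_le_zero le_zero_eq neq0_conv order_refl)
  \<comment> \<open>The boundary term \<open>f m / m\<close> of the partial summation is kept so
    that the induction closes; it is replaced by \<open>C\<close> only at the end.\<close>
  have "G m \<le> f m / m + C * (ln (real m - 1) - ln (real a - 1))"
    using \<open>a \<le> m\<close> le
  proof (induction m rule: dec_induct)
    case base
    have "G a = 0" unfolding G_def by (rule sum.neutral) auto
    then show ?case unfolding f_def by simp
  next
    case (step j)
    have split1: "{u \<in> F. a \<le> c u \<and> c u < Suc j} = {u \<in> F. a \<le> c u \<and> c u < j} \<union> {u \<in> F. c u = j}"
      using step(1) by auto
    have split2: "{u \<in> F. c u < Suc j} = {u \<in> F. c u < j} \<union> {u \<in> F. c u = j}" by auto
    have G: "G (Suc j) = G j + real (card {u \<in> F. c u = j}) / j"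
      unfolding G_def split1 using fin by (subst sum.union_disjoint) auto
    have f: "f (Suc j) = f j + real (card {u \<in> F. c u = j})"
      unfolding f_def split2 using fin by (subst card_Un_disjoint) auto
    have j: "real j \<ge> 2" using step(1) a by simp
    have IH: "G j \<le> f j / j + C * (ln (real j - 1) - ln (real a - 1))" using step by auto
    have fle: "f (Suc j) \<le> C * (j + 1)" using step.prems[of "Suc j"] step(1) unfolding f_def
      by (simp add: add.commute)
    have l: "1 / real j \<le> ln (real j) - ln (real j - 1)"
    proof -
      have "ln ((real j - 1) / real j) \<le> (real j - 1) / real j - 1"
        using j by (intro ln_le_minus_one) auto
      then show ?thesis using j by (simp add: ln_div field_simps)
    qed
    have "f (Suc j) / j - f (Suc j) / (j + 1) = f (Suc j) / (j + 1) * (1 / j)"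
      using j by (simp add: field_simps)
    also have "\<dots> \<le> C * (1 / j)"
      using fle j by (intro mult_right_mono) (auto simp: field_simps)
    also have "\<dots> \<le> C * (ln (real j) - ln (real j - 1))" using l C0 by (rule mult_left_mono)
    finally have 1: "f (Suc j) / j \<le> f (Suc j) / (j + 1) + C * (ln (real j) - ln (real j - 1))"
      by simp
    have "G (Suc j) = G j + (f (Suc j) - f j) / j" using G f by simp
    also have "\<dots> \<le> f (Suc j) / j + C * (ln (real j - 1) - ln (real a - 1))"
      using IH by (simp add: diff_divide_distrib)
    also have "\<dots> \<le> f (Suc j) / (j + 1) + C * (ln (real j) - ln (real a - 1))"
      using 1 by (simp add: algebra_simps)
    finally show ?case by (simp add: add.commute)
  qed
  moreover have "f m / m \<le> C" using le[of m] a unfolding f_def by (simp add: field_simps)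
  moreover have "C * (ln (real m - 1) - ln (real a - 1)) \<le> C * ln (real m / (real a - 1))"
    using a by (intro mult_left_mono[OF _ C0]) (simp add: ln_div)
  ultimately show ?thesis unfolding G_def by (simp add: algebra_simps)
qed

section \<open>Cores in a star system\<close>

text \<open>
  \<open>N v u\<close> is the set of possible spines of the pair \<open>{v, u}\<close>. A pair is charged to \<open>v\<close> if
  \<open>u \<in> A v\<close>, and \<open>F v\<close> contains those charged \<open>u\<close> for which the star \<open>S v\<close> supplies too few spines;
  their own sets \<open>N v u\<close> must then not be small too often. A vertex without a star has \<open>S v = {}\<close>
  and all its charged pairs in \<open>F v\<close>; any \<open>y v \<ge> 18 * t\<close> will then do.
\<close>

locale star_system =
  fixes t :: nat and X :: "nat set" and A S F :: "nat \<Rightarrow> nat set" and y :: "nat \<Rightarrow> nat"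
    and N :: "nat \<Rightarrow> nat \<Rightarrow> nat set"
  assumes t: "t \<ge> 10"
    and fin_X: "finite X"
    and fin_N: "finite (N v u)"
    and N_commute: "N v u = N u v"
    and A_total: "v \<in> X \<Longrightarrow> u \<in> X \<Longrightarrow> v \<noteq> u \<Longrightarrow> u \<in> A v \<or> v \<in> A u"
    and fin_S: "v \<in> X \<Longrightarrow> finite (S v)"
    and card_S: "v \<in> X \<Longrightarrow> card (S v) \<le> y v"
    and y_ge: "v \<in> X \<Longrightarrow> y v \<ge> 18 * t"
    and F_irrefl: "v \<notin> F v"
    and star: "v \<in> X \<Longrightarrow> u \<in> X \<Longrightarrow> u \<in> A v \<Longrightarrow> u \<noteq> v \<Longrightarrow> u \<notin> F v \<Longrightarrow>
                 2 * y v \<le> 3 * card (N v u \<inter> S v)"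
    and F_sparse: "v \<in> X \<Longrightarrow> 6 * t \<le> j \<Longrightarrow> j \<le> 10 * t\<^sup>2 \<Longrightarrow>
                 card {u \<in> X \<inter> F v. card (N v u) < j} \<le> 3 * j"
    and load_le: "(\<Sum>v\<in>X. if w \<in> S v then 1 / real (y v) else 0) \<le> 2 + 1 / 180"
    and card_X: "real (card X) \<ge> 200 / 3 * (real t)\<^sup>2 * (ln (real t) + 2)"
begin

text \<open>Exceptional pairs are treated by their number of spines: below \<open>6 * t\<close> they
  are kept out of the core, below \<open>10 * t\<^sup>2\<close> their reciprocals are budgeted, and
  beyond that all pairs together still cause little load.\<close>

definition low :: "nat \<Rightarrow> nat set" where
  "low v = {u \<in> X \<inter> F v. card (N v u) < 6 * t}"

definition mid :: "nat \<Rightarrow> nat set" where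
  "mid v = {u \<in> X \<inter> F v. 6 * t \<le> card (N v u) \<and> card (N v u) < 10 * t\<^sup>2}"

text \<open>The inner product of the measures that give each point of a star weight
  \<open>1 / y\<close>; summed over \<open>u\<close> it becomes a sum of loads over
  \<open>S v\<close>.\<close>

definition overlap :: "nat \<Rightarrow> nat \<Rightarrow> real" where
  "overlap v u = real (card (S v \<inter> S u)) / (real (y v) * real (y u))"

lemma y_pos: "v \<in> X \<Longrightarrow> real (y v) > 0"
  using y_ge[of v] t by simp

lemma ln_t: "ln (real t) \<ge> 2"
proof -
  have "exp 2 = exp (1::real) * exp 1" by (simp flip: exp_add)
  also have "\<dots> \<le> 3 * 3"
    using exp_le by (intro mult_mono) auto
  also have "\<dots> \<le> real t" using t by simp
  finally show ?thesis using t by (simp add: ln_ge_iff)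
qed

lemma sum_low: 
  assumes "v \<in> X"
  shows "(\<Sum>u\<in>X. of_bool (u \<in> low v) / real t) \<le> 18"
proof -
  have "6 * t \<le> 10 * t\<^sup>2" using t by (simp add: power2_eq_square)
  then have "card (low v) \<le> 18 * t" using F_sparse[OF assms, of "6 * t"] unfolding low_def by simp
  moreover have "(\<Sum>u\<in>X. of_bool (u \<in> low v) / real t) = real (card (low v)) / t"
    using fin_X unfolding low_def
    by (simp add: sum_divide_distrib[symmetric] sum.If_cases of_bool_def Int_def conj_ac)
  ultimately show ?thesis using t by (simp add: divide_le_eq)
qed

text \<open>\<open>F_sparse\<close> bounds the counts by \<open>3 * j\<close> at every scale of this
  range, so the sum is harmonic; the logarithm of the theorem arises here.\<close>

lemma sum_mid:
  assumes "v \<in> X"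
  shows "(\<Sum>u\<in>X. of_bool (u \<in> mid v) / real (card (N v u))) \<le> 3 * (ln (real t) + 2)"
proof -
  have m: "6 * t \<le> 10 * t\<^sup>2" using t by (simp add: power2_eq_square)
  have "mid v \<subseteq> X" unfolding mid_def by auto
  then have "X \<inter> mid v = mid v" by auto
  then have "(\<Sum>u\<in>X. of_bool (u \<in> mid v) / real (card (N v u))) = (\<Sum>u\<in>mid v. 1 / real (card (N v u)))"
    using sum.inter_restrict[OF fin_X, of "\<lambda>u. 1 / real (card (N v u))" "mid v"]
    by (simp add: of_bool_def if_distrib[of "\<lambda>x. x / _"] cong: if_cong)
  also have "\<dots> \<le> 3 * (1 + ln (real (10 * t\<^sup>2) / (real (6 * t) - 1)))"
    unfolding mid_def
  proof (rule sum_inverse_le_ln)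
    fix j assume "6 * t \<le> j" "j \<le> 10 * t\<^sup>2"
    from F_sparse[OF assms this] show "real (card {u \<in> X \<inter> F v. card (N v u) < j}) \<le> 3 * real j"
      by linarith
  qed (use fin_X t m in auto)
  also have "ln (real (10 * t\<^sup>2) / (real (6 * t) - 1)) \<le> ln (2 * real t)"
  proof (subst ln_le_cancel_iff)
    show "real (10 * t\<^sup>2) / (real (6 * t) - 1) \<le> 2 * real t"
      using t by (simp add: divide_simps) (simp add: power2_eq_square algebra_simps)
  qed (use t in auto)
  also have "ln (2 * real t) \<le> 1 + ln (real t)"
    using t ln_le_minus_one[of "2::real"] by (simp add: ln_mult)
  finally show ?thesis by simp
qed

lemma sum_card_Int:
  assumes "finite Y" "Y \<subseteq> X" "v \<in> X"
  shows "(\<Sum>u\<in>Y. real (card (S v \<inter> S u)) / y u) = (\<Sum>w\<in>S v. \<Sum>u\<in>Y. if w \<in> S u then 1 / real (y u) else 0)"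
proof -
  have "real (card (S v \<inter> S u)) / y u = (\<Sum>w\<in>S v. if w \<in> S u then 1 / real (y u) else 0)" for u
    using fin_S[OF assms(3)] by (simp add: sum.If_cases)
  then show ?thesis by (simp add: sum.swap[of _ Y])
qed

text \<open>After swapping the sums, at most \<open>y v\<close> points of the star each carry load
  at most \<open>2 + 1 / 180\<close>, and the total is divided by \<open>y v\<close>.\<close>

lemma sum_overlap:
  assumes "v \<in> X"
  shows "(\<Sum>u\<in>X. overlap v u) \<le> 2 + 1 / 180"
proof -
  have "(\<Sum>u\<in>X. overlap v u) = (\<Sum>u\<in>X. real (card (S v \<inter> S u)) / y u) / y v"
    unfolding overlap_def by (simp add: sum_divide_distrib mult.commute)
  also have "\<dots> = (\<Sum>w\<in>S v. \<Sum>u\<in>X. if w \<in> S u then 1 / real (y u) else 0) / y v"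
    using sum_card_Int[OF fin_X subset_refl assms] by simp
  also have "\<dots> \<le> (\<Sum>w\<in>S v. 2 + 1 / 180) / y v"
    by (intro divide_right_mono sum_mono load_le) auto
  also have "\<dots> \<le> (y v * (2 + 1 / 180)) / y v"
    using card_S[OF assms] by (intro divide_right_mono) auto
  also have "\<dots> = 2 + 1 / 180" using y_pos[OF assms] by simp
  finally show ?thesis .
qed

lemma obtain_core:
  obtains T where "T \<subseteq> X" "card T = t" "\<And>v u. v \<in> T \<Longrightarrow> u \<in> T \<Longrightarrow> u \<notin> low v"
    "\<And>v. v \<in> T \<Longrightarrow> (\<Sum>u\<in>T - {v}. overlap v u) \<le> 7 / (54 * real t)"
    "(\<Sum>v\<in>T. \<Sum>u\<in>T. of_bool (u \<in> mid v) / real (card (N v u))) \<le> 37 / 100"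
proof -
  txt \<open>Normalised so that a total weight of at most 1 leaves at most \<open>t\<close> vertices \<open>v\<close> of the random
    \<open>2 * t\<close>-set that have a partner in \<open>low v\<close> or too large an overlap, while \<open>e\<close> sums to at most 0.37.\<close>
  define a where "a v u = of_bool (u \<in> low v) / real t" for v u
  define b where "b v u = (if u = v then 0 else 54 / 7 * overlap v u)" for v u
  define e where "e v u = of_bool (u \<in> mid v) / real (card (N v u))" for v u
  define g where "g v u = a v u + b v u + 100 / 37 * e v u" for v u
  define l where "l = ln (real t) + 2"
  have l: "l \<ge> 4" using ln_t unfolding l_def by simp
  have a0: "a v u \<ge> 0" and b0: "b v u \<ge> 0" and e0: "e v u \<ge> 0" for v u
    unfolding a_def b_def e_def overlap_def by simp_all
  have t2: "(real t)\<^sup>2 > 0" using t by simp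
  \<comment> \<open>The constant terms amount to about 33.5 and \<open>300 / 37\<close> to about
    8.1, so \<open>66 / 4\<close> suffices because \<open>l \<ge> 4\<close>.\<close>
  have "(\<Sum>u\<in>X. g v u) \<le> 66 / 4 * l" if "v \<in> X" for v
  proof -
    have "(\<Sum>u\<in>X. b v u) \<le> (\<Sum>u\<in>X. 54 / 7 * overlap v u)"
      by (intro sum_mono) (auto simp: b_def overlap_def)
    also have "\<dots> \<le> 54 / 7 * (2 + 1 / 180)"
      using sum_overlap[OF that] unfolding sum_distrib_left[symmetric] by simp
    finally have "(\<Sum>u\<in>X. b v u) \<le> 54 / 7 * (2 + 1 / 180)" .
    moreover have "(\<Sum>u\<in>X. a v u) \<le> 18" "(\<Sum>u\<in>X. e v u) \<le> 3 * l"
      using sum_low[OF that] sum_mid[OF that] unfolding a_def e_def l_def .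
    ultimately have "(\<Sum>u\<in>X. g v u) \<le> 18 + 54 / 7 * (2 + 1 / 180) + 100 / 37 * (3 * l)"
      unfolding g_def sum.distrib sum_distrib_left[symmetric] by simp
    then show ?thesis using l by simp
  qed
  then have "(\<Sum>v\<in>X. \<Sum>u\<in>X. g v u) \<le> (\<Sum>v\<in>X. 66 / 4 * l)" by (intro sum_mono)
  then have tot: "(\<Sum>v\<in>X. \<Sum>u\<in>X. g v u) \<le> card X * (66 / 4 * l)" by simp
  have cX: "real (card X) \<ge> 200 / 3 * (real t)\<^sup>2 * l" using card_X unfolding l_def .
  have "2 * real t \<le> 200 / 3 * (real t)\<^sup>2 * 4" using t by (simp add: power2_eq_square)
  also have "\<dots> \<le> 200 / 3 * (real t)\<^sup>2 * l" using l t2 by (intro mult_left_mono) auto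
  finally have s: "2 * t \<le> card X" using cX by linarith
  have X0: "real (card X) > 0" using s t by linarith
  have irr: "g v v = 0" for v
    using F_irrefl unfolding g_def a_def b_def e_def low_def mid_def by simp
  have "\<exists>R\<subseteq>X. card R = 2 * t \<and>
    (\<Sum>v\<in>R. \<Sum>u\<in>R. g v u) \<le> (real (2 * t) / card X)\<^sup>2 * (\<Sum>v\<in>X. \<Sum>u\<in>X. g v u)"
    using a0 b0 e0 irr s t fin_X by (intro sparse_subset) (auto simp: g_def)
  then obtain R where R: "R \<subseteq> X" "card R = 2 * t"
    "(\<Sum>v\<in>R. \<Sum>u\<in>R. g v u) \<le> (real (2 * t) / card X)\<^sup>2 * (\<Sum>v\<in>X. \<Sum>u\<in>X. g v u)" by blast
  have finR: "finite R" using R fin_X finite_subset by blast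
  \<comment> \<open>The factor \<open>4 * (66 / 4) = 66\<close> stays below the constant
    \<open>200 / 3\<close> of \<open>card_X\<close>, so the total weight is at most 1.\<close>
  have "(\<Sum>v\<in>R. \<Sum>u\<in>R. g v u) \<le> (real (2 * t) / card X)\<^sup>2 * (card X * (66 / 4 * l))"
    using R(3) tot by (meson mult_left_mono order_trans zero_le_power2)
  also have "\<dots> = 66 * (real t)\<^sup>2 * l / card X"
    using X0 by (simp add: power2_eq_square field_simps)
  also have "\<dots> \<le> 1"
  proof -
    have "66 * ((real t)\<^sup>2 * l) \<le> 200 / 3 * ((real t)\<^sup>2 * l)" using l by (intro mult_right_mono) auto
    then show ?thesis using cX X0 by (simp add: field_simps)
  qed
  finally have small: "(\<Sum>v\<in>R. \<Sum>u\<in>R. a v u) + (\<Sum>v\<in>R. \<Sum>u\<in>R. b v u)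
      + 100 / 37 * (\<Sum>v\<in>R. \<Sum>u\<in>R. e v u) \<le> 1"
    unfolding g_def by (simp add: sum.distrib sum_distrib_left)
  have sa0: "(\<Sum>v\<in>R. \<Sum>u\<in>R. a v u) \<ge> 0" and sb0: "(\<Sum>v\<in>R. \<Sum>u\<in>R. b v u) \<ge> 0"
    and se0: "(\<Sum>v\<in>R. \<Sum>u\<in>R. e v u) \<ge> 0" by (intro sum_nonneg a0 b0 e0)+
  \<comment> \<open>Each vertex of \<open>Bad1\<close> contributes at least \<open>1 / t\<close> to
    the sum of \<open>a\<close> and each of \<open>Bad2\<close> at least \<open>1 / t\<close> to
    that of \<open>b\<close>, so there are at most \<open>t\<close> of them altogether.\<close>
  define Bad1 where "Bad1 = {v \<in> R. \<exists>u\<in>R. u \<in> low v}"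
  define Bad2 where "Bad2 = {v \<in> R. (\<Sum>u\<in>R - {v}. overlap v u) > 7 / (54 * real t)}"
  have "card Bad1 / t = (\<Sum>v\<in>Bad1. 1 / real t)" by simp
  also have "\<dots> \<le> (\<Sum>v\<in>Bad1. \<Sum>u\<in>R. a v u)"
  proof (rule sum_mono)
    fix v assume "v \<in> Bad1"
    then obtain u where "u \<in> R" "u \<in> low v" unfolding Bad1_def by blast
    then show "1 / real t \<le> (\<Sum>u\<in>R. a v u)"
      using member_le_sum[of u R "a v"] a0 finR unfolding a_def by simp
  qed
  also have "\<dots> \<le> (\<Sum>v\<in>R. \<Sum>u\<in>R. a v u)"
    by (intro sum_mono2 sum_nonneg a0 finR) (auto simp: Bad1_def)
  finally have B1: "card Bad1 / t \<le> (\<Sum>v\<in>R. \<Sum>u\<in>R. a v u)" .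
  have "card Bad2 / t = (\<Sum>v\<in>Bad2. 1 / real t)" by simp
  also have "\<dots> \<le> (\<Sum>v\<in>Bad2. \<Sum>u\<in>R. b v u)"
  proof (rule sum_mono)
    fix v assume v: "v \<in> Bad2"
    then have "1 / real t \<le> 54 / 7 * (\<Sum>u\<in>R - {v}. overlap v u)"
      unfolding Bad2_def by (simp add: field_simps)
    also have "\<dots> = (\<Sum>u\<in>R - {v}. b v u)"
      unfolding sum_distrib_left b_def by (intro sum.cong) auto
    also have "\<dots> \<le> (\<Sum>u\<in>R. b v u)" by (intro sum_mono2 finR b0) auto
    finally show "1 / real t \<le> (\<Sum>u\<in>R. b v u)" .
  qed
  also have "\<dots> \<le> (\<Sum>v\<in>R. \<Sum>u\<in>R. b v u)"
    by (intro sum_mono2 sum_nonneg b0 finR) (auto simp: Bad2_def)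
  finally have B2: "card Bad2 / t \<le> (\<Sum>v\<in>R. \<Sum>u\<in>R. b v u)" .
  have fB: "finite Bad1" "finite Bad2" using finR unfolding Bad1_def Bad2_def by auto
  have "real (card (Bad1 \<union> Bad2)) \<le> card Bad1 + card Bad2" using card_Un_le of_nat_mono by blast
  also have "\<dots> = (card Bad1 / t + card Bad2 / t) * t" using t by (simp add: field_simps)
  also have "\<dots> \<le> 1 * real t" using B1 B2 small se0 by (intro mult_right_mono) auto
  finally have "card (Bad1 \<union> Bad2) \<le> t" by simp
  then have "card (R - (Bad1 \<union> Bad2)) \<ge> t"
    using diff_card_le_card_Diff[of "Bad1 \<union> Bad2" R] fB R(2) by simp
  then obtain T where T: "T \<subseteq> R - (Bad1 \<union> Bad2)" "card T = t"
    by (meson obtain_subset_with_card_n)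
  have TR: "T \<subseteq> R" using T(1) by blast
  show ?thesis
  proof (rule that[of T])
    show "u \<notin> low v" if "v \<in> T" "u \<in> T" for v u
      using that T(1) unfolding Bad1_def by blast
    show "(\<Sum>u\<in>T - {v}. overlap v u) \<le> 7 / (54 * real t)" if "v \<in> T" for v
    proof -
      have "(\<Sum>u\<in>T - {v}. overlap v u) \<le> (\<Sum>u\<in>R - {v}. overlap v u)"
        using TR finR by (intro sum_mono2) (auto simp: overlap_def)
      moreover have "v \<in> R" "v \<notin> Bad2" using that T(1) by auto
      ultimately show ?thesis unfolding Bad2_def by auto
    qed
    have "(\<Sum>v\<in>T. \<Sum>u\<in>T. e v u) \<le> (\<Sum>v\<in>T. \<Sum>u\<in>R. e v u)"
      by (intro sum_mono sum_mono2 finR TR e0)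
    also have "\<dots> \<le> (\<Sum>v\<in>R. \<Sum>u\<in>R. e v u)" by (intro sum_mono2 sum_nonneg finR TR e0)
    also have "\<dots> \<le> 37 / 100" using small sa0 sb0 by simp
    finally show "(\<Sum>v\<in>T. \<Sum>u\<in>T. of_bool (u \<in> mid v) / real (card (N v u))) \<le> 37 / 100"
      unfolding e_def .
  qed (use T R in auto)
qed

lemma representatives:
  obtains T \<kappa> where "T \<subseteq> X" "card T = t" "inj_on \<kappa> (nsets T 2)"
    "\<And>v u. v \<in> T \<Longrightarrow> u \<in> T \<Longrightarrow> v \<noteq> u \<Longrightarrow> \<kappa> {v, u} \<in> N v u - T"
proof -
  obtain T where TX: "T \<subseteq> X" and cT: "card T = t"
    and nlow: "\<And>v u. v \<in> T \<Longrightarrow> u \<in> T \<Longrightarrow> u \<notin> low v"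
    and ov: "\<And>v. v \<in> T \<Longrightarrow> (\<Sum>u\<in>T - {v}. overlap v u) \<le> 7 / (54 * real t)"
    and midT: "(\<Sum>v\<in>T. \<Sum>u\<in>T. of_bool (u \<in> mid v) / real (card (N v u))) \<le> 37 / 100"
    by (rule obtain_core) blast
  have finT: "finite T" using TX fin_X finite_subset by blast
  \<comment> \<open>Each pair is oriented so that its first vertex is charged; if both are, the
    smaller comes first, so that every pair occurs once.\<close>
  define Q where "Q = {(v, u) \<in> T \<times> T. v \<noteq> u \<and> u \<in> A v \<and> (v \<in> A u \<longrightarrow> v < u)}"
  have QT: "Q \<subseteq> T \<times> T" unfolding Q_def by auto
  have finQ: "finite Q" using QT finT finite_subset by blast
  have uniq: "p = q" if "p \<in> Q" "q \<in> Q" "{fst p, snd p} = {fst q, snd q}" for p q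
    using that by (auto simp: Q_def doubleton_eq_iff)
  have cQ: "card Q \<le> t choose 2"
  proof -
    have "inj_on (\<lambda>p. {fst p, snd p}) Q" using uniq by (auto intro: inj_onI)
    moreover have "(\<lambda>p. {fst p, snd p}) ` Q \<subseteq> nsets T 2" by (auto simp: Q_def nsets_def)
    ultimately show ?thesis
      using card_inj_on_le[of _ Q "nsets T 2"] finT cT finite_imp_finite_nsets[of T 2] by simp
  qed
  txt \<open>A star pair spreads its unit over its part of the star, damped by \<open>h\<close> where many stars meet:
    \<open>L\<close> is the undamped load, so the damped one is \<open>h w * L w \<le> 1 / 2\<close>, and by
    \<open>1 - h w \<le> L w / 2\<close> the damping costs little. A pair in \<open>F\<close> spreads its unit uniformly;
    such pairs load a vertex by at most \<open>6 / 5 * 37 / 100 + 5 / 99\<close>.\<close>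
  define M where "M p = (if snd p \<in> F (fst p) then N (fst p) (snd p) - T
      else N (fst p) (snd p) \<inter> S (fst p) - T)" for p
  define L where "L w = (\<Sum>v\<in>T. if w \<in> S v then 3 * t / y v else 0)" for w
  define h where "h w = (if L w \<le> 1 / 2 then 1 else 1 / (2 * L w))" for w
  define f where "f p w = (if snd p \<in> F (fst p) then 1 / card (M p) else 3 * h w / y (fst p))" for p w
  define a where "a w v = (if w \<in> S v then 3 * h w / y v else 0)" for w v
  define b where "b v u = 6 / 5 * (of_bool (u \<in> mid v) / real (card (N v u)))" for v u
  define c where "c = 10 / (99 * (real t)\<^sup>2)"
  have h0: "h w \<ge> 0" and h1: "h w \<ge> 1 - L w / 2" and hL: "h w * L w \<le> 1 / 2" for w
  proof -
    have L0: "L w \<ge> 0" unfolding L_def by (intro sum_nonneg) auto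
    then show "h w \<ge> 0" unfolding h_def by auto
    show "h w * L w \<le> 1 / 2" unfolding h_def using L0 by auto
    show "h w \<ge> 1 - L w / 2"
    proof (cases "L w \<le> 1 / 2")
      case False
      have "0 \<le> (L w - 1)\<^sup>2" by simp
      then have "(2 - L w) * L w \<le> 1" by (simp add: power2_eq_square algebra_simps)
      then show ?thesis using False unfolding h_def by (simp add: field_simps)
    qed (use L0 in \<open>auto simp: h_def\<close>)
  qed
  have finM: "finite (M p)" for p unfolding M_def using fin_N by auto
  \<comment> \<open>With at least \<open>6 * t\<close> spines, removing the \<open>t\<close>
    vertices of the core costs at most one sixth of them.\<close>
  have big: "6 * t \<le> card (N v u)" "real (card (N v u - T)) \<ge> 5 / 6 * real (card (N v u))"
    "real (card (N v u - T)) \<ge> real (card (N v u)) - t"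
    if "v \<in> T" "u \<in> T" "u \<in> F v" for v u
  proof -
    show 1: "6 * t \<le> card (N v u)" using nlow[OF that(1,2)] that TX unfolding low_def by auto
    have "card (N v u) - t \<le> card (N v u - T)"
      using diff_card_le_card_Diff[OF finT, of "N v u"] cT by simp
    then show 2: "real (card (N v u - T)) \<ge> real (card (N v u)) - t" by linarith
    with 1 show "real (card (N v u - T)) \<ge> 5 / 6 * real (card (N v u))" by linarith
  qed
  have one: "(\<Sum>w\<in>M p. f p w) \<ge> 1" if pQ: "p \<in> Q" for p
  proof -
    obtain v u where p: "p = (v, u)" by fastforce
    have vu: "v \<in> T" "u \<in> T" "v \<noteq> u" "u \<in> A v" using pQ p unfolding Q_def by auto
    have vX: "v \<in> X" and uX: "u \<in> X" using vu TX by auto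
    show ?thesis
    proof (cases "u \<in> F v")
      case True
      have "real (card (N v u - T)) > 0" using big(1,2)[OF vu(1,2) True] t by linarith
      then show ?thesis unfolding f_def M_def p using True by simp
    next
      case False
      have Mp: "M p = N v u \<inter> S v - T" unfolding M_def p using False by simp
      have "2 * y v \<le> 3 * card (N v u \<inter> S v)" using star vX uX vu False by metis
      moreover have "card (N v u \<inter> S v) - t \<le> card (M p)"
        using diff_card_le_card_Diff[OF finT, of "N v u \<inter> S v"] cT Mp by simp
      ultimately have cM: "real (card (M p)) \<ge> 2 / 3 * y v - t" by linarith
      \<comment> \<open>The star of \<open>v\<close> itself contributes at most
        \<open>3 * t\<close>; the other stars of \<open>T\<close> contribute through their overlaps
        with it.\<close>
      have "(\<Sum>w\<in>S v. L w) = 3 * t * (\<Sum>w\<in>S v. \<Sum>u\<in>T. if w \<in> S u then 1 / real (y u) else 0)"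
        unfolding L_def sum_distrib_left by (intro sum.cong) auto
      also have "\<dots> = 3 * t * (\<Sum>u\<in>T. real (card (S v \<inter> S u)) / y u)"
        using sum_card_Int[OF finT TX vX] by simp
      also have "(\<Sum>u\<in>T. real (card (S v \<inter> S u)) / y u)
          = card (S v) / y v + (\<Sum>u\<in>T - {v}. real (card (S v \<inter> S u)) / y u)"
        using sum.remove[OF finT vu(1), of "\<lambda>u. real (card (S v \<inter> S u)) / y u"] by simp
      also have "(\<Sum>u\<in>T - {v}. real (card (S v \<inter> S u)) / y u) = y v * (\<Sum>u\<in>T - {v}. overlap v u)"
        unfolding overlap_def sum_distrib_left using y_pos[OF vX] by (intro sum.cong) auto
      also have "card (S v) / y v \<le> 1" using card_S[OF vX] y_pos[OF vX] by simp
      also have "y v * (\<Sum>u\<in>T - {v}. overlap v u) \<le> y v * (7 / (54 * real t))"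
        by (intro mult_left_mono ov vu) auto
      also have "3 * t * (1 + y v * (7 / (54 * real t))) = 3 * t + 7 / 18 * y v"
        using t by (simp add: field_simps)
      finally have SL: "(\<Sum>w\<in>S v. L w) \<le> 3 * t + 7 / 18 * y v" by (simp add: mult_left_mono)
      have "(\<Sum>w\<in>M p. L w) \<le> (\<Sum>w\<in>S v. L w)"
        using Mp fin_S[OF vX] unfolding L_def by (intro sum_mono2 sum_nonneg) auto
      with SL have "(\<Sum>w\<in>M p. L w) \<le> 3 * t + 7 / 18 * y v" by linarith
      moreover have "(\<Sum>w\<in>M p. h w) \<ge> (\<Sum>w\<in>M p. 1 - L w / 2)" by (intro sum_mono h1)
      moreover have "(\<Sum>w\<in>M p. 1 - L w / 2) = card (M p) - (\<Sum>w\<in>M p. L w) / 2"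
        by (simp add: sum_subtractf sum_divide_distrib)
      moreover have "real (y v) \<ge> 18 * real t" using y_ge[OF vX] by linarith
      \<comment> \<open>The balance is exact:
        \<open>2 / 3 * y v - t - (3 * t + 7 / 18 * y v) / 2\<close> equals
        \<open>17 / 36 * y v - 5 / 2 * t\<close>, which is at least \<open>y v / 3\<close> precisely
        when \<open>y v \<ge> 18 * t\<close>. This ties the overlap bound \<open>7 / 54\<close> to
        the star size.\<close>
      ultimately have Z: "(\<Sum>w\<in>M p. h w) \<ge> y v / 3" using cM by linarith
      have "(\<Sum>w\<in>M p. f p w) = 3 / y v * (\<Sum>w\<in>M p. h w)"
        unfolding f_def p using False by (simp add: sum_distrib_left)
      also have "\<dots> \<ge> 3 / y v * (y v / 3)" using Z by (intro mult_left_mono) auto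
      finally show ?thesis using y_pos[OF vX] by simp
    qed
  qed
  \<comment> \<open>Each pair is paid for by one of three budgets: \<open>a\<close> for star pairs,
    \<open>b\<close> for pairs in \<open>mid\<close>, where \<open>6 / 5\<close> makes up for
    removing \<open>T\<close>, and \<open>c\<close> for pairs with at least
    \<open>10 * t\<^sup>2\<close> spines, of which \<open>99 / 10 * t\<^sup>2\<close>
    remain.\<close>
  have fle: "(if w \<in> M p then f p w else 0) \<le> a w (fst p) + b (fst p) (snd p) + c"
    if pQ: "p \<in> Q" for p w
  proof -
    obtain v u where p: "p = (v, u)" by fastforce
    have vu: "v \<in> T" "u \<in> T" "v \<noteq> u" "u \<in> A v" using pQ p unfolding Q_def by auto
    have a0: "a w v \<ge> 0" and b0: "b v u \<ge> 0" and c0: "c \<ge> 0"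
      unfolding a_def b_def c_def using h0 by auto
    show ?thesis
    proof (cases "w \<in> M p")
      case wM: True
      show ?thesis
      proof (cases "u \<in> F v")
        case False
        then have "f p w = a w v" using wM unfolding f_def a_def p M_def by auto
        then show ?thesis using b0 c0 wM p by simp
      next
        case True
        have fp: "f p w = 1 / card (N v u - T)" using True unfolding f_def M_def p by simp
        note bg = big[OF vu(1,2) True]
        have pos: "real (card (N v u)) > 0" using bg(1) t by linarith
        show ?thesis
        proof (cases "card (N v u) < 10 * t\<^sup>2")
          case lt: True
          have "u \<in> mid v" unfolding mid_def using lt bg(1) True vu TX by auto
          moreover have "1 / card (N v u - T) \<le> 1 / (5 / 6 * real (card (N v u)))"
            using bg(2) pos by (intro divide_left_mono) auto
          ultimately have "f p w \<le> b v u" unfolding fp b_def by simp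
          then show ?thesis using a0 c0 wM p by simp
        next
          case False
          then have "real (card (N v u)) \<ge> 10 * (real t)\<^sup>2"
            by (metis linorder_not_less of_nat_le_iff of_nat_mult of_nat_numeral of_nat_power)
          moreover have "10 * real t \<le> (real t)\<^sup>2" using t by (simp add: power2_eq_square)
          ultimately have "real (card (N v u - T)) \<ge> 99 / 10 * (real t)\<^sup>2" using bg(3) by linarith
          moreover have "99 / 10 * (real t)\<^sup>2 > 0" using t by simp
          ultimately have "1 / card (N v u - T) \<le> 1 / (99 / 10 * (real t)\<^sup>2)"
            by (intro divide_left_mono mult_pos_pos) linarith+
          then have "f p w \<le> c" unfolding fp c_def by simp
          then show ?thesis using a0 b0 wM p by simp
        qed
      qed
    qed (use a0 b0 c0 p in auto)
  qed
  have load: "(\<Sum>p\<in>Q. if w \<in> M p then f p w else 0) \<le> 1" for w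
  proof -
    have "(\<Sum>p\<in>Q. if w \<in> M p then f p w else 0) \<le> (\<Sum>p\<in>Q. (a w (fst p) + b (fst p) (snd p)) + c)"
      by (intro sum_mono fle)
    also have "\<dots> = (\<Sum>p\<in>Q. a w (fst p) + b (fst p) (snd p)) + card Q * c"
      by (subst sum.distrib) simp
    also have "(\<Sum>p\<in>Q. a w (fst p) + b (fst p) (snd p)) \<le> (\<Sum>p\<in>T \<times> T. a w (fst p) + b (fst p) (snd p))"
      using QT finT h0 by (intro sum_mono2) (auto simp: a_def b_def)
    also have "\<dots> = (\<Sum>v\<in>T. \<Sum>u\<in>T. a w v + b v u)"
      by (simp add: sum.cartesian_product case_prod_beta)
    also have "\<dots> = t * (\<Sum>v\<in>T. a w v) + (\<Sum>v\<in>T. \<Sum>u\<in>T. b v u)"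
      by (simp add: sum.distrib cT sum_distrib_left)
    \<comment> \<open>The \<open>t\<close> possible second coordinates explain the factor
      \<open>t\<close> in \<open>L\<close>. The three budgets add up to
      \<open>1 / 2 + 0.444 + 5 / 99 < 1\<close>.\<close>
    also have "t * (\<Sum>v\<in>T. a w v) = h w * L w"
      unfolding a_def L_def sum_distrib_left by (intro sum.cong) auto
    also have "h w * L w \<le> 1 / 2" by (rule hL)
    also have "(\<Sum>v\<in>T. \<Sum>u\<in>T. b v u) \<le> 6 / 5 * (37 / 100)"
      unfolding b_def sum_distrib_left[symmetric] using midT by linarith
    also have "card Q * c \<le> ((real t)\<^sup>2 / 2) * c"
    proof (rule mult_right_mono)
      have "2 * card Q \<le> t * (t - 1)" using cQ by (simp add: choose_two)
      also have "\<dots> \<le> t\<^sup>2" by (simp add: power2_eq_square)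
      finally have "real (2 * card Q) \<le> real (t\<^sup>2)" by (rule of_nat_mono)
      then show "real (card Q) \<le> (real t)\<^sup>2 / 2" by simp
    qed (simp add: c_def)
    also have "((real t)\<^sup>2 / 2) * c = 5 / 99" using t unfolding c_def by simp
    finally show ?thesis by simp
  qed
  have nn: "f p w \<ge> 0" for p w unfolding f_def using h0 by auto
  obtain r where r: "inj_on r Q" "\<forall>p\<in>Q. r p \<in> M p"
    using fractional_marriage[OF finQ finM nn one load] by blast
  define pr where "pr e = (SOME p. p \<in> Q \<and> {fst p, snd p} = e)" for e
  have pr: "pr e \<in> Q" "{fst (pr e), snd (pr e)} = e" if "e \<in> nsets T 2" for e
  proof -
    obtain v u where vu: "e = {v, u}" "v \<noteq> u"
      using \<open>e \<in> nsets T 2\<close> unfolding nsets_def card_2_iff by blast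
    moreover from this have "v \<in> T" "u \<in> T" using \<open>e \<in> nsets T 2\<close> unfolding nsets_def by auto
    ultimately have "(v, u) \<in> Q \<or> (u, v) \<in> Q"
      using A_total[of v u] TX unfolding Q_def by auto
    then have "\<exists>p. p \<in> Q \<and> {fst p, snd p} = e" using vu(1) by (auto simp: insert_commute)
    from someI_ex[OF this] show "pr e \<in> Q" "{fst (pr e), snd (pr e)} = e" unfolding pr_def by auto
  qed
  show ?thesis
  proof (rule that[OF TX cT, of "r \<circ> pr"])
    show "inj_on (r \<circ> pr) (nsets T 2)"
      using pr r(1) by (intro inj_onI) (metis comp_apply inj_onD)
    fix v u assume vu: "v \<in> T" "u \<in> T" "v \<noteq> u"
    then have "{v, u} \<in> nsets T 2" by (auto simp: nsets_def)
    note p = pr[OF this]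
    have "N (fst (pr {v, u})) (snd (pr {v, u})) = N v u"
      using p(2) N_commute by (auto simp: doubleton_eq_iff)
    then show "(r \<circ> pr) {v, u} \<in> N v u - T"
      using r(2) p(1) unfolding M_def by (auto split: if_splits)
  qed
qed

end

section \<open>Peeling off stars\<close>

text \<open>The neighbourhood of the pair in colour \<open>b\<close>: its cardinality is the
  codegree, and its elements are the possible spines.\<close>

definition link :: "(nat set \<Rightarrow> bool) \<Rightarrow> nat \<Rightarrow> bool \<Rightarrow> nat \<Rightarrow> nat \<Rightarrow> nat set" where
  "link c n b v u = {w \<in> {..<n}. w \<noteq> u \<and> w \<noteq> v \<and> c {u, v, w} = b}"

definition sparse_nbrs :: "(nat set \<Rightarrow> bool) \<Rightarrow> nat \<Rightarrow> bool \<Rightarrow> nat \<Rightarrow> nat \<Rightarrow> nat set \<Rightarrow> nat set" where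
  "sparse_nbrs c n b d v U = {u \<in> U - {v}. card (link c n b v u) < d}"

lemma finite_link [simp]: "finite (link c n b v u)"
  unfolding link_def by simp

lemma link_commute: "link c n b v u = link c n b u v"
  unfolding link_def by (auto simp: insert_commute)

text \<open>Double counting of the triples of colour \<open>\<not> b\<close> through
  \<open>v\<close>, a failing \<open>u\<close> and a star vertex \<open>w\<close>: each
  \<open>u\<close> lies in at least \<open>d\<close> of them, each of the \<open>3 * d\<close>
  vertices \<open>w\<close> in at most \<open>d - 1\<close>.\<close>

lemma card_star_failures:
  assumes S: "S \<subseteq> sparse_nbrs c n (\<not> b) d v U" and cS: "card S = 3 * d" and U: "U \<subseteq> {..<n}" and v: "v < n"
  shows "card {u \<in> U - {v}. 3 * card (link c n b v u \<inter> S) < 2 * (3 * d)} \<le> 3 * (d - 1)"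
proof (cases "d = 0")
  case False
  define F where "F = {u \<in> U - {v}. 3 * card (link c n b v u \<inter> S) < 2 * (3 * d)}"
  have finU: "finite U" using U finite_subset by blast
  then have finF: "finite F" and finS: "finite S"
    using S finite_subset[of S U] unfolding F_def sparse_nbrs_def by auto
  have "card F * d = (\<Sum>u\<in>F. d)" by simp
  also have "\<dots> \<le> (\<Sum>u\<in>F. card {w \<in> S. u \<in> link c n (\<not> b) v w})"
  proof (rule sum_mono)
    fix u assume u: "u \<in> F"
    have "S - (link c n b v u \<inter> S) - {u} \<subseteq> {w \<in> S. u \<in> link c n (\<not> b) v w}"
      using u S U v by (auto simp: F_def sparse_nbrs_def link_def insert_commute)
    then have "card (S - (link c n b v u \<inter> S) - {u}) \<le> card {w \<in> S. u \<in> link c n (\<not> b) v w}"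
      using finS by (intro card_mono) auto
    moreover have "card (S - (link c n b v u \<inter> S)) - card {u} \<le> card (S - (link c n b v u \<inter> S) - {u})"
      by (rule diff_card_le_card_Diff) simp
    moreover have "card S - card (link c n b v u \<inter> S) \<le> card (S - (link c n b v u \<inter> S))"
      by (rule diff_card_le_card_Diff) (use finS in auto)
    \<comment> \<open>Strictness leaves at least \<open>d + 1\<close> star vertices outside the
      link, hence \<open>d\<close> even if \<open>u\<close> itself is one of them.\<close>
    moreover have "card (link c n b v u \<inter> S) < 2 * d" using u unfolding F_def by simp
    ultimately show "d \<le> card {w \<in> S. u \<in> link c n (\<not> b) v w}" using cS by simp
  qed
  also have "\<dots> = (\<Sum>u\<in>F. \<Sum>w\<in>S. if u \<in> link c n (\<not> b) v w then 1 else 0)"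
    using finS by (intro sum.cong refl) (simp add: sum.If_cases Int_def)
  also have "\<dots> = (\<Sum>w\<in>S. \<Sum>u\<in>F. if u \<in> link c n (\<not> b) v w then 1 else 0)" by (rule sum.swap)
  also have "\<dots> \<le> (\<Sum>w\<in>S. d - 1)"
  proof (rule sum_mono)
    fix w assume w: "w \<in> S"
    have "(\<Sum>u\<in>F. if u \<in> link c n (\<not> b) v w then 1 else 0) = card (F \<inter> link c n (\<not> b) v w)"
      using finF by (simp add: sum.If_cases)
    also have "\<dots> \<le> card (link c n (\<not> b) v w)" by (intro card_mono) auto
    also have "\<dots> \<le> d - 1" using w S unfolding sparse_nbrs_def by auto
    finally show "(\<Sum>u\<in>F. if u \<in> link c n (\<not> b) v w then 1 else 0) \<le> d - 1" .
  qed
  also have "\<dots> = 3 * (d - 1) * d" using cS by simp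
  finally show ?thesis using False unfolding F_def by simp
qed (use assms in simp)

definition load :: "nat set \<Rightarrow> (nat \<Rightarrow> nat set) \<Rightarrow> (nat \<Rightarrow> nat) \<Rightarrow> nat \<Rightarrow> real" where
  "load C S d w = (\<Sum>v\<in>C. if w \<in> S v then 1 / real (3 * d v) else 0)"

definition rest :: "nat \<Rightarrow> nat set \<Rightarrow> (nat \<Rightarrow> nat set) \<Rightarrow> (nat \<Rightarrow> nat) \<Rightarrow> nat set" where
  "rest n C S d = {w \<in> {..<n} - C. load C S d w < 2}"

text \<open>
  \<open>C\<close> is the set of centres removed so far and \<open>A v\<close> the set of vertices left when \<open>v\<close> was removed;
  \<open>d v\<close> is the least scale at which \<open>v\<close> had many sparse neighbours in \<open>A v\<close> in some colour.
  A vertex whose load has reached 2 is discarded; as the loads add up to \<open>card C\<close>, at most half as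
  many vertices are discarded as there are centres.
\<close>

definition peeling :: "nat \<Rightarrow> (nat set \<Rightarrow> bool) \<Rightarrow> nat \<Rightarrow> nat set \<Rightarrow> (nat \<Rightarrow> nat set) \<Rightarrow>
    (nat \<Rightarrow> nat set) \<Rightarrow> (nat \<Rightarrow> nat) \<Rightarrow> (nat \<Rightarrow> bool) \<Rightarrow> bool" where
  "peeling t c n C A S d col \<longleftrightarrow> C \<subseteq> {..<n} \<and>
     (\<forall>w. load C S d w \<le> 2 + 1 / 180) \<and>
     (\<forall>v\<in>C. \<forall>u\<in>C. v \<noteq> u \<longrightarrow> u \<in> A v \<or> v \<in> A u) \<and>
     (\<forall>v\<in>C. rest n C S d \<subseteq> A v \<and> A v \<subseteq> {..<n} \<and> 6 * t \<le> d v \<and> d v \<le> 10 * t\<^sup>2 \<and>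
        S v \<subseteq> sparse_nbrs c n (\<not> col v) (d v) v (A v) \<and> card (S v) = 3 * d v \<and>
        (\<forall>b e. 6 * t \<le> e \<and> e < d v \<longrightarrow> card (sparse_nbrs c n b e v (A v)) < 3 * e))"

text \<open>The new star is taken at the least heavy scale, so minimality gives the clause on
  smaller scales, and the load grows only where it was below 2.\<close>

lemma peeling_extend:
  assumes t: "t \<ge> 10" and P: "peeling t c n C A S d col" and v: "v \<in> rest n C S d"
    and j: "6 * t \<le> j" "j \<le> 10 * t\<^sup>2" "card (sparse_nbrs c n b j v (rest n C S d)) \<ge> 3 * j"
  shows "\<exists>A S d col. peeling t c n (insert v C) A S d col"
proof -
  define U where "U = rest n C S d"
  \<comment> \<open>Quantifying over the colour makes minimality control the sparse neighbours in
    both colours.\<close>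
  define heavy where "heavy i \<longleftrightarrow> 6 * t \<le> i \<and> i \<le> 10 * t\<^sup>2 \<and> (\<exists>b. card (sparse_nbrs c n b i v U) \<ge> 3 * i)" for i
  have "heavy j" using j unfolding heavy_def U_def by blast
  define k where "k = (LEAST i. heavy i)"
  have k: "heavy k" unfolding k_def using \<open>heavy j\<close> by (rule LeastI)
  then obtain b' where b': "card (sparse_nbrs c n b' k v U) \<ge> 3 * k" unfolding heavy_def by blast
  have k_bounds: "6 * t \<le> k" "k \<le> 10 * t\<^sup>2" using k unfolding heavy_def by auto
  obtain R where R: "R \<subseteq> sparse_nbrs c n b' k v U" "card R = 3 * k"
    by (rule obtain_subset_with_card_n[OF b'])
  have below: "card (sparse_nbrs c n b e v U) < 3 * e" if "6 * t \<le> e" "e < k" for b e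
  proof -
    have "\<not> heavy e" using that(2) unfolding k_def by (rule not_less_Least)
    moreover have "e \<le> 10 * t\<^sup>2" using that k_bounds by simp
    ultimately show ?thesis using that(1) unfolding heavy_def by (meson not_less)
  qed
  have vC: "v \<notin> C" and vn: "v < n" using v unfolding rest_def by auto
  have Cn: "C \<subseteq> {..<n}" using P unfolding peeling_def by blast
  then have finC: "finite C" using finite_subset by blast
  have RU: "R \<subseteq> U - {v}" using R(1) unfolding sparse_nbrs_def by auto
  let ?S = "S(v := R)" and ?d = "d(v := k)"
  have ld: "load (insert v C) ?S ?d w = load C S d w + (if w \<in> R then 1 / real (3 * k) else 0)" for w
  proof -
    have "(\<Sum>v'\<in>C. if w \<in> ?S v' then 1 / real (3 * ?d v') else 0) = load C S d w"
      unfolding load_def using vC by (intro sum.cong) auto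
    then show ?thesis using vC finC unfolding load_def by (subst sum.insert) auto
  qed
  then have ld_ge: "load (insert v C) ?S ?d w \<ge> load C S d w" for w by simp
  have rest: "rest n (insert v C) ?S ?d \<subseteq> U"
    unfolding U_def rest_def using ld_ge by (auto intro: le_less_trans)
  \<comment> \<open>The increment is at most \<open>1 / 180\<close> because
    \<open>3 * k \<ge> 18 * t \<ge> 180\<close>.\<close>
  have ld_le: "load (insert v C) ?S ?d w \<le> 2 + 1 / 180" for w
  proof (cases "w \<in> R")
    case True
    then have "load C S d w < 2" using RU unfolding U_def rest_def by auto
    moreover have "1 / real (3 * k) \<le> 1 / 180" using k_bounds t by (intro divide_left_mono) auto
    ultimately show ?thesis using ld[of w] True by simp
  qed (use ld P in \<open>auto simp: peeling_def\<close>)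
  have Un: "U \<subseteq> {..<n}" unfolding U_def rest_def by auto
  have UA: "U \<subseteq> A u" "v \<in> A u" if "u \<in> C" for u
    using P v that unfolding peeling_def U_def by blast+
  \<comment> \<open>The pairs from \<open>v\<close> to its star are sparse in \<open>b'\<close>, so
    the star supplies spines in the opposite colour, which becomes the colour of
    \<open>v\<close>.\<close>
  have "peeling t c n (insert v C) (A(v := U)) ?S ?d (col(v := \<not> b'))"
    unfolding peeling_def
  proof (intro conjI ballI)
    fix u assume u: "u \<in> insert v C"
    show "rest n (insert v C) ?S ?d \<subseteq> (A(v := U)) u"
      using rest UA u by auto
    show "(A(v := U)) u \<subseteq> {..<n}" "6 * t \<le> ?d u" "?d u \<le> 10 * t\<^sup>2" "card (?S u) = 3 * ?d u"
      "?S u \<subseteq> sparse_nbrs c n (\<not> (col(v := \<not> b')) u) (?d u) u ((A(v := U)) u)"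
      "\<forall>b e. 6 * t \<le> e \<and> e < ?d u \<longrightarrow> card (sparse_nbrs c n b e u ((A(v := U)) u)) < 3 * e"
      using u P Un R k_bounds below unfolding peeling_def by auto
    fix u' assume u': "u' \<in> insert v C"
    show "u \<noteq> u' \<longrightarrow> u' \<in> (A(v := U)) u \<or> u \<in> (A(v := U)) u'"
      using u u' UA(2) P unfolding peeling_def by auto
  qed (use ld_le Cn vn in auto)
  then show ?thesis by blast
qed

text \<open>A peeling with the most centres is taken; a vertex of \<open>rest\<close> violating the
  bound could be peeled next.\<close>

lemma obtain_peeling:
  assumes t: "t \<ge> 10"
  obtains C A S d col where "peeling t c n C A S d col"
    "\<And>v j b. v \<in> rest n C S d \<Longrightarrow> 6 * t \<le> j \<Longrightarrow> j \<le> 10 * t\<^sup>2 \<Longrightarrow>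
       card (sparse_nbrs c n b j v (rest n C S d)) < 3 * j"
proof -
  define P where "P C \<longleftrightarrow> (\<exists>A S d col. peeling t c n C A S d col)" for C
  have "P {}" unfolding P_def peeling_def load_def by simp
  moreover have "\<forall>C. P C \<longrightarrow> card C < Suc n"
    unfolding P_def peeling_def by (metis card_lessThan card_mono finite_lessThan less_Suc_eq_le)
  ultimately obtain C where C: "P C" "\<And>C'. P C' \<Longrightarrow> card C' \<le> card C"
    using ex_has_greatest_nat[of P "{}" card "Suc n"] by auto
  then obtain A S d col where pl: "peeling t c n C A S d col" unfolding P_def by blast
  have "card (sparse_nbrs c n b j v (rest n C S d)) < 3 * j"
    if "v \<in> rest n C S d" "6 * t \<le> j" "j \<le> 10 * t\<^sup>2" for v j b
  proof (rule ccontr)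
    assume "\<not> ?thesis"
    then have "P (insert v C)" unfolding P_def
      by (intro peeling_extend[OF t pl that, of b]) simp
    moreover have "finite C" using pl finite_subset unfolding peeling_def by blast
    moreover have "v \<notin> C" using that(1) unfolding rest_def by auto
    ultimately show False using C(2) by fastforce
  qed
  with pl show ?thesis by (rule that)
qed

lemma card_rest:
  assumes "peeling t c n C A S d col" and "t \<ge> 10"
  shows "2 * n \<le> 2 * card (rest n C S d) + 3 * card C"
proof -
  have Cn: "C \<subseteq> {..<n}" using assms unfolding peeling_def by blast
  then have finC: "finite C" using finite_subset by blast
  define D where "D = {..<n} - C - rest n C S d"
  have Sn: "S v \<subseteq> {..<n}" "card (S v) = 3 * d v" "d v > 0" if "v \<in> C" for v
  proof -
    have "S v \<subseteq> sparse_nbrs c n (\<not> col v) (d v) v (A v)" "A v \<subseteq> {..<n}" "6 * t \<le> d v"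
      "card (S v) = 3 * d v" using assms that unfolding peeling_def by auto
    then show "S v \<subseteq> {..<n}" "card (S v) = 3 * d v" "d v > 0"
      using assms(2) unfolding sparse_nbrs_def by auto
  qed
  have "2 * real (card D) = (\<Sum>w\<in>D. 2)" by simp
  also have "\<dots> \<le> (\<Sum>w\<in>D. load C S d w)" by (intro sum_mono) (auto simp: D_def rest_def)
  also have "\<dots> \<le> (\<Sum>w<n. load C S d w)"
    unfolding load_def by (intro sum_mono2 sum_nonneg) (auto simp: D_def)
  also have "\<dots> = (\<Sum>v\<in>C. \<Sum>w<n. if w \<in> S v then 1 / real (3 * d v) else 0)"
    unfolding load_def by (rule sum.swap)
  also have "\<dots> = (\<Sum>v\<in>C. 1)"
  proof (rule sum.cong[OF refl])
    fix v assume v: "v \<in> C"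
    have "(\<Sum>w<n. if w \<in> S v then 1 / real (3 * d v) else 0) = card ({..<n} \<inter> S v) / real (3 * d v)"
      by (simp add: sum.If_cases)
    also have "{..<n} \<inter> S v = S v" using Sn(1)[OF v] by auto
    finally show "(\<Sum>w<n. if w \<in> S v then 1 / real (3 * d v) else 0) = 1" using Sn[OF v] by simp
  qed
  finally have "2 * card D \<le> card C" by simp
  moreover have "n = card C + card (rest n C S d) + card D"
  proof -
    have "rest n C S d \<subseteq> {..<n} - C" unfolding rest_def by auto
    then have "{..<n} = C \<union> rest n C S d \<union> D" and "C \<inter> rest n C S d = {}" "(C \<union> rest n C S d) \<inter> D = {}"
      using Cn unfolding D_def by auto
    moreover have "finite (rest n C S d)" "finite D" unfolding rest_def D_def by auto
    ultimately show ?thesis using finC by (metis card_Un_disjoint card_lessThan finite_UnI)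
  qed
  ultimately show ?thesis by linarith
qed

text \<open>The centres of the more frequent colour and the remaining vertices, which serve for
  either colour, form a star system for the links in that colour.\<close>

lemma core_with_spines:
  fixes c :: "nat set \<Rightarrow> bool"
  assumes t: "t \<ge> 10" and n: "real n \<ge> 200 * (real t)\<^sup>2 * (ln (real t) + 2)"
  obtains b T \<kappa> where "T \<subseteq> {..<n}" "card T = t" "inj_on \<kappa> (nsets T 2)"
    "\<And>v u. v \<in> T \<Longrightarrow> u \<in> T \<Longrightarrow> v \<noteq> u \<Longrightarrow> \<kappa> {v, u} \<in> link c n b v u - T"
proof -
  obtain C A S d col where pl: "peeling t c n C A S d col"
    and tame: "\<And>v j b. v \<in> rest n C S d \<Longrightarrow> 6 * t \<le> j \<Longrightarrow> j \<le> 10 * t\<^sup>2 \<Longrightarrow>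
       card (sparse_nbrs c n b j v (rest n C S d)) < 3 * j"
    using obtain_peeling[OF t, of c n] by blast
  define L where "L = rest n C S d"
  define Cb where "Cb b = {v \<in> C. col v = b}" for b
  have Cn: "C \<subseteq> {..<n}" using pl unfolding peeling_def by blast
  then have finC: "finite C" using finite_subset by blast
  have Ln: "L \<subseteq> {..<n} - C" unfolding L_def rest_def by auto
  then have finL: "finite L" using finite_subset by blast
  have cC: "card C = card (Cb True) + card (Cb False)"
  proof -
    have "card (Cb True \<union> Cb False) = card (Cb True) + card (Cb False)"
      using finC by (intro card_Un_disjoint) (auto simp: Cb_def)
    moreover have "Cb True \<union> Cb False = C" unfolding Cb_def by auto
    ultimately show ?thesis by simp
  qed
  \<comment> \<open>For the larger class, \<open>card_rest\<close> gives \<open>2 * n \<le> 2 * card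
    L + 3 * card C \<le> 2 * card L + 6 * card (Cb b)\<close>.\<close>
  have "\<exists>b. n \<le> 3 * (card L + card (Cb b))"
  proof (cases "card (Cb True) \<le> card (Cb False)")
    case True
    with card_rest[OF pl t] cC have "n \<le> 3 * (card L + card (Cb False))" unfolding L_def by auto
    then show ?thesis ..
  next
    case False
    with card_rest[OF pl t] cC have "n \<le> 3 * (card L + card (Cb True))" unfolding L_def by auto
    then show ?thesis ..
  qed
  then obtain b where b: "n \<le> 3 * (card L + card (Cb b))" by blast
  define X where "X = L \<union> Cb b"
  have cX: "card X = card L + card (Cb b)"
    unfolding X_def using finC finL Ln by (intro card_Un_disjoint) (auto simp: Cb_def)
  \<comment> \<open>A pair of a centre and a remaining vertex is charged to the centre, since
    \<open>L\<close> lies in every \<open>A v\<close>; pairs inside \<open>L\<close> have no star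
    and are all exceptional.\<close>
  define A' where "A' v = (if v \<in> L then L else A v)" for v
  define S' where "S' v = (if v \<in> L then {} else S v)" for v
  define y where "y v = (if v \<in> L then 18 * t else 3 * d v)" for v
  define F where "F v = (if v \<in> L then L - {v}
      else {u \<in> A v - {v}. 3 * card (link c n b v u \<inter> S v) < 2 * (3 * d v)})" for v
  have finX: "finite X" unfolding X_def Cb_def using finC finL by simp
  have centre: "v \<in> C" "v < n" "A v \<subseteq> {..<n}" "L \<subseteq> A v" "6 * t \<le> d v" "d v \<le> 10 * t\<^sup>2"
      "S v \<subseteq> sparse_nbrs c n (\<not> b) (d v) v (A v)" "card (S v) = 3 * d v"
      "\<And>b e. 6 * t \<le> e \<Longrightarrow> e < d v \<Longrightarrow> card (sparse_nbrs c n b e v (A v)) < 3 * e"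
    if "v \<in> X" "v \<notin> L" for v
    using that pl Cn unfolding X_def Cb_def peeling_def L_def by auto
  interpret star_system t X A' S' F y "link c n b"
  proof
    fix v assume v: "v \<in> X"
    show "finite (S' v)"
      unfolding S'_def using centre(7,3)[OF v] finite_subset[of "S v" "{..<n}"]
      by (auto simp: sparse_nbrs_def)
    show "card (S' v) \<le> y v" unfolding S'_def y_def using centre(8)[OF v] by auto
    show "18 * t \<le> y v" unfolding y_def using centre(5)[OF v] by auto
    fix j assume j: "6 * t \<le> j" "j \<le> 10 * t\<^sup>2"
    \<comment> \<open>Three reasons apply: the maximality of the peeling for \<open>v\<close> in
      \<open>L\<close>, the minimality of \<open>d v\<close> for \<open>j < d v\<close>, and for
      larger \<open>j\<close> the bound on all star failures.\<close>
    show "card {u \<in> X \<inter> F v. card (link c n b v u) < j} \<le> 3 * j"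
    proof (cases "v \<in> L")
      case True
      have "card {u \<in> X \<inter> F v. card (link c n b v u) < j} \<le> card (sparse_nbrs c n b j v L)"
        using finL True by (intro card_mono) (auto simp: sparse_nbrs_def F_def)
      then show ?thesis using tame[of v j b] j True unfolding L_def by simp
    next
      case False
      note ce = centre[OF v False]
      have finA: "finite (A v)" using ce(3) finite_subset by blast
      show ?thesis
      proof (cases "j < d v")
        case True
        have "card {u \<in> X \<inter> F v. card (link c n b v u) < j} \<le> card (sparse_nbrs c n b j v (A v))"
          using finA False by (intro card_mono) (auto simp: sparse_nbrs_def F_def)
        then show ?thesis using ce(9)[OF j(1) True, of b] by simp
      next
        case jd: False
        have "card {u \<in> X \<inter> F v. card (link c n b v u) < j} \<le> card (F v)"
          using finA False by (intro card_mono) (auto simp: F_def)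
        also have "\<dots> \<le> 3 * (d v - 1)"
          unfolding F_def using card_star_failures[OF ce(7,8,3,2)] False by simp
        finally show ?thesis using jd by simp
      qed
    qed
  next
    fix v u assume vu: "v \<in> X" "u \<in> X" "v \<noteq> u"
    show "u \<in> A' v \<or> v \<in> A' u"
    proof (cases "v \<in> L \<or> u \<in> L")
      case True
      then show ?thesis using centre(4) vu unfolding A'_def by auto
    next
      case False
      then show ?thesis using vu pl centre(1) unfolding A'_def peeling_def by auto
    qed
  next
    fix v u assume "v \<in> X" "u \<in> X" "u \<in> A' v" "u \<noteq> v" "u \<notin> F v"
    then show "2 * y v \<le> 3 * card (link c n b v u \<inter> S' v)"
      unfolding A'_def F_def S'_def y_def by (auto split: if_splits)
  next
    fix w
    have "(\<Sum>v\<in>X. if w \<in> S' v then 1 / real (y v) else 0)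
        = (\<Sum>v\<in>Cb b. if w \<in> S v then 1 / real (3 * d v) else 0)"
      using Ln finX unfolding X_def
      by (intro sum.mono_neutral_cong_right) (auto simp: S'_def y_def Cb_def split: if_splits)
    also have "\<dots> \<le> load C S d w"
      unfolding load_def using finC by (intro sum_mono2) (auto simp: Cb_def)
    also have "\<dots> \<le> 2 + 1 / 180" using pl unfolding peeling_def by blast
    finally show "(\<Sum>v\<in>X. if w \<in> S' v then 1 / real (y v) else 0) \<le> 2 + 1 / 180" .
  next
    show "200 / 3 * (real t)\<^sup>2 * (ln (real t) + 2) \<le> real (card X)"
    proof -
      have "real n \<le> real (3 * card X)" using b cX by (intro of_nat_mono) simp
      with n show ?thesis by simp
    qed
  qed (use t finX link_commute in \<open>auto simp: F_def\<close>)
  obtain T \<kappa> where "T \<subseteq> X" "card T = t" "inj_on \<kappa> (nsets T 2)"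
    "\<And>v u. v \<in> T \<Longrightarrow> u \<in> T \<Longrightarrow> v \<noteq> u \<Longrightarrow> \<kappa> {v, u} \<in> link c n b v u - T"
    by (rule representatives) blast
  moreover have "X \<subseteq> {..<n}" unfolding X_def Cb_def using Ln Cn by auto
  ultimately show ?thesis using that by blast
qed

section \<open>The hedgehog\<close>

lemma card_ordered_pairs: "card {(i, j). 1 \<le> i \<and> i < j \<and> j \<le> (t::nat)} = t choose 2"
proof -
  let ?P = "{(i, j). 1 \<le> i \<and> i < j \<and> j \<le> t}"
  have "inj_on (\<lambda>(i, j). {i, j}) ?P" by (auto simp: inj_on_def doubleton_eq_iff)
  moreover have "(\<lambda>(i, j). {i, j}) ` ?P = nsets {1..t} 2"
  proof (intro equalityI subsetI)
    fix e assume e: "e \<in> nsets {1..t} 2"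
    then obtain a b where ab: "e = {a, b}" "a \<noteq> b" unfolding nsets_def card_2_iff by blast
    then have "{min a b, max a b} = e" "1 \<le> min a b" "min a b < max a b" "max a b \<le> t"
      using e by (auto simp: nsets_def min_def max_def)
    then show "e \<in> (\<lambda>(i, j). {i, j}) ` ?P" by (intro image_eqI[of _ _ "(min a b, max a b)"]) auto
  qed (auto simp: nsets_def)
  ultimately have "card ?P = card (nsets {1..t} 2)" by (metis (no_types, lifting) card_image)
  then show ?thesis by simp
qed

text \<open>The vertices up to \<open>t\<close> go to \<open>T\<close> and \<open>k i j\<close> goes
  to the spine of the image pair; spines avoid \<open>T\<close> and differ for different pairs, so
  the map is injective.\<close>

lemma has_mono_copy_hedgehog:
  assumes H: "is_hedgehog t H" and T: "T \<subseteq> {..<n}" "card T = t" and \<kappa>: "inj_on \<kappa> (nsets T 2)"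
    and link: "\<And>v u. v \<in> T \<Longrightarrow> u \<in> T \<Longrightarrow> v \<noteq> u \<Longrightarrow> \<kappa> {v, u} \<in> link c n b v u - T"
  shows "has_mono_copy H (complete_3graph n) c"
proof -
  obtain k where "(\<forall>i j. 1 \<le> i \<and> i < j \<and> j \<le> t \<longrightarrow> k i j \<in> {t<..t + (t choose 2)}) \<and>
      inj_on (\<lambda>(i, j). k i j) {(i, j). 1 \<le> i \<and> i < j \<and> j \<le> t} \<and>
      H = ({1..t + (t choose 2)}, {{i, j, k i j} | i j. 1 \<le> i \<and> i < j \<and> j \<le> t})"
    using H unfolding is_hedgehog_def ..
  note k = this[THEN conjunct1] this[THEN conjunct2, THEN conjunct1]
    and Heq = this[THEN conjunct2, THEN conjunct2]
  define P where "P = {(i, j). 1 \<le> i \<and> i < j \<and> j \<le> t}"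
  define K where "K = (\<lambda>(i, j). k i j)"
  \<comment> \<open>By counting, \<open>k\<close> reaches every vertex above \<open>t\<close>, so
    \<open>inv_into P K\<close> below recovers the pair of each such vertex.\<close>
  have KP: "K ` P = {t<..t + (t choose 2)}"
  proof (rule card_subset_eq)
    show "K ` P \<subseteq> {t<..t + (t choose 2)}" using k(1) unfolding K_def P_def by auto
    show "card (K ` P) = card {t<..t + (t choose 2)}"
      using card_image[OF k(2)] card_ordered_pairs[of t] unfolding K_def P_def by simp
  qed simp
  have KI: "inj_on K P" using k(2) unfolding K_def P_def .
  have finT: "finite T" using T(1) finite_subset by blast
  obtain g where g: "bij_betw g {1..t} T"
    using finite_same_card_bij[of "{1..t}" T] finT T(2) by auto
  have gT: "g i \<in> T" if "1 \<le> i" "i \<le> t" for i using g that by (auto simp: bij_betw_def)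
  have g_eq: "g i = g j \<longleftrightarrow> i = j" if "1 \<le> i" "i \<le> t" "1 \<le> j" "j \<le> t" for i j
    using inj_on_eq_iff[OF bij_betw_imp_inj_on[OF g], of i j] that by simp
  define spine where "spine p = \<kappa> {g (fst p), g (snd p)}" for p
  have spine: "spine p \<in> link c n b (g (fst p)) (g (snd p)) - T" if "p \<in> P" for p
    unfolding spine_def using that by (intro link gT) (auto simp: P_def g_eq)
  have spine_inj: "p = q" if pq: "p \<in> P" "q \<in> P" "spine p = spine q" for p q
  proof -
    have "{g (fst p), g (snd p)} \<in> nsets T 2" if "p \<in> P" for p
      using that gT by (auto simp: P_def nsets_def g_eq card_insert_if)
    then have "{g (fst p), g (snd p)} = {g (fst q), g (snd q)}"
      using \<kappa> pq unfolding spine_def by (meson inj_onD)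
    then show ?thesis using pq(1,2) by (auto simp: P_def doubleton_eq_iff g_eq)
  qed
  define f where "f x = (if x \<le> t then g x else spine (inv_into P K x))" for x
  have inv: "inv_into P K x \<in> P" "K (inv_into P K x) = x" if "x \<in> {t<..t + (t choose 2)}" for x
    using that KP by (auto intro: inv_into_into f_inv_into_f)
  have inj: "inj_on f {1..t + (t choose 2)}"
  proof (rule linorder_inj_onI)
    fix x z assume xz: "x < z" "x \<in> {1..t + (t choose 2)}" "z \<in> {1..t + (t choose 2)}"
    show "f x \<noteq> f z"
    proof (cases "z \<le> t")
      case True
      then show ?thesis using xz g_eq unfolding f_def by auto
    next
      case False
      then have z: "inv_into P K z \<in> P" "K (inv_into P K z) = z" using inv xz by auto
      show ?thesis
      proof (cases "x \<le> t")
        case True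
        then show ?thesis using False xz gT[of x] spine[OF z(1)] unfolding f_def by auto
      next
        case x: False
        then have x': "inv_into P K x \<in> P" "K (inv_into P K x) = x" using inv xz by auto
        then have "inv_into P K x \<noteq> inv_into P K z" using z(2) xz(1) by auto
        then have "spine (inv_into P K x) \<noteq> spine (inv_into P K z)" using spine_inj x'(1) z(1) by blast
        then show ?thesis using x False unfolding f_def by simp
      qed
    qed
  qed auto
  have "f ` {1..t + (t choose 2)} \<subseteq> {..<n}"
  proof (rule image_subsetI)
    fix x assume x: "x \<in> {1..t + (t choose 2)}"
    show "f x \<in> {..<n}"
    proof (cases "x \<le> t")
      case True
      then show ?thesis using gT[of x] x T(1) unfolding f_def by auto
    next
      case False
      then show ?thesis using spine[OF inv(1)[of x]] x unfolding f_def link_def by auto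
    qed
  qed
  moreover have "f ` {i, j, k i j} \<in> nsets {..<n} 3 \<and> c (f ` {i, j, k i j}) = b"
    if ij: "1 \<le> i" "i < j" "j \<le> t" for i j
  proof -
    have p: "(i, j) \<in> P" using ij unfolding P_def by auto
    have "k i j > t" using k(1) ij by auto
    moreover have "inv_into P K (k i j) = (i, j)"
      using inv_into_f_f[OF KI p] unfolding K_def by simp
    ultimately have f: "f ` {i, j, k i j} = {g i, g j, spine (i, j)}"
      using ij unfolding f_def by auto
    have "g i \<noteq> g j" "g i < n" "g j < n" using ij g_eq gT T(1) by (auto simp: subset_iff)
    moreover have "spine (i, j) \<in> link c n b (g i) (g j)" using spine[OF p] by simp
    ultimately show ?thesis unfolding f by (auto simp: link_def nsets_def insert_commute)
  qed
  ultimately show ?thesis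
    unfolding has_mono_copy_def complete_3graph_def Heq using inj
    by (intro exI[of _ f] exI[of _ b]) auto
qed

theorem theorem1p2:
  fixes t :: nat and H :: "nat hypergraph"
  assumes "t \<ge> 10" and "is_hedgehog t H"
  shows "(\<forall>n::nat. real n \<ge> 200 * (real t)^2 * ln (real t) + 400 * (real t)^2 \<longrightarrow>
            (\<forall>c. has_mono_copy H (complete_3graph n) c)) \<and>
         real (ramsey_number H) < 200 * (real t)^2 * ln (real t) + 400 * (real t)^2 + 1"
proof -
  define B where "B = 200 * (real t)^2 * ln (real t) + 400 * (real t)^2"
  have B: "B = 200 * (real t)\<^sup>2 * (ln (real t) + 2)" unfolding B_def by (simp add: algebra_simps)
  have mono: "has_mono_copy H (complete_3graph n) c" if n: "real n \<ge> B" for n c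
  proof -
    obtain T \<kappa> b where "T \<subseteq> {..<n}" "card T = t" "inj_on \<kappa> (nsets T 2)"
      "\<And>v u. v \<in> T \<Longrightarrow> u \<in> T \<Longrightarrow> v \<noteq> u \<Longrightarrow> \<kappa> {v, u} \<in> link c n b v u - T"
      by (rule core_with_spines[OF assms(1) n[unfolded B], of c]) blast
    then show ?thesis by (rule has_mono_copy_hedgehog[OF assms(2)])
  qed
  have "B \<ge> 0" unfolding B using assms(1) by simp
  \<comment> \<open>The ceiling of \<open>B\<close> already has the arrow property and exceeds
    \<open>B\<close> by less than 1, whence the strict bound \<open>B + 1\<close>.\<close>
  have "ramsey_number H \<le> nat \<lceil>B\<rceil>"
    unfolding ramsey_number_def arrows_def
    by (rule Least_le) (use mono real_nat_ceiling_ge in blast)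
  then have "real (ramsey_number H) \<le> real (nat \<lceil>B\<rceil>)" by simp
  also have "\<dots> < B + 1" using \<open>B \<ge> 0\<close> by linarith
  finally show ?thesis using mono unfolding B_def by blast
qed

end
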